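(* Let $\delta=0.195$, and let $\mathbf{a}=\{a_1,\dots,a_n\}$ and $\mathbf{b}=\{b_1,\dots,b_n\}$ be subsets (each with $n$ elements) of the open disk $B\left(0,\sqrt{\tfrac{\delta}{1+\delta}}\right)\subset\mathbb{D}$, with $\mathbf{a}\cap\mathbf{b}=\emptyset$. Then $$\det\left(\frac{1}{(1-a_i\overline{b}_j)^2}\right)_{1\le i,j\le n}\neq 0.$$
   Context: $\mathbb{D}$ is the open unit disk of $\mathbb{C}$ and $B(0,r)=\{z\in\mathbb{C}:|z|<r\}$. *)

theory Defs
  imports Complex_Main "HOL-Analysis.Elementary_Metric_Spaces" "Jordan_Normal_Form.Determinant"
begin

end

theory Submission
  imports Defs
begin

text \<open>
  Put \<open>m i j = 1 / (1 - x i * y j)\<close>. Muir's identity writes \<open>det m * per m\<close> as the sum over all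
  permutations \<open>\<tau>\<close> of the determinants of \<open>m i j * m i (\<tau> j)\<close>. For \<open>\<tau> \<noteq> id\<close> the columns of that
  matrix are dependent with coefficients \<open>y j - y (\<tau> j)\<close>, so only \<open>\<tau> = id\<close> contributes. This is
  Borchardt's identity: the determinant of the squares is \<open>det m * per m\<close>. The Cauchy
  determinant does not vanish because the points are distinct. The permanent does not vanish
  by an argument of Barvinok: all entries are within \<open>0.195\<close> of \<open>1\<close>, and induction on the size
  shows that changing one column turns the permanent only through a small angle.
\<close>

section \<open>Permanents\<close>

text \<open>Two separate index sets make deleting a row or a column a matter of deleting an element,
  as expansion along a row requires. Extensionality ensures that each bijection is counted
  once.\<close>

definition per :: "('a \<Rightarrow> 'b \<Rightarrow> 'c::comm_ring_1) \<Rightarrow> 'a set \<Rightarrow> 'b set \<Rightarrow> 'c" where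
  "per z I J = (\<Sum>f\<in>{f \<in> I \<rightarrow>\<^sub>E J. bij_betw f I J}. \<Prod>i\<in>I. z i (f i))"

lemma per_empty [simp]: "per z {} {} = 1"
proof -
  have *: "{f. f = (\<lambda>_. undefined) \<and> bij_betw f {} {}} = {\<lambda>_. undefined}"
    by (auto simp: bij_betw_def)
  show ?thesis by (simp add: per_def *)
qed

text \<open>Passing to the inverse bijection exchanges rows and columns; \<open>restrict\<close>
  makes the inverse extensional again.\<close>

lemma per_transpose: "per z I J = per (\<lambda>j i. z i j) J I"
  unfolding per_def
proof (rule sum.reindex_bij_witness
    [where i = "\<lambda>g. restrict (inv_into J g) I" and j = "\<lambda>f. restrict (inv_into I f) J"])
  \<comment> \<open>Fresh types and sets let this fact serve for both round trips, from
    \<open>I\<close> to \<open>J\<close> and back.\<close>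
  have *: "restrict (inv_into J (restrict (inv_into I f) J)) I = f"
    if "f \<in> I \<rightarrow>\<^sub>E J" "bij_betw f I J" for f :: "'x \<Rightarrow> 'y" and I J
  proof
    fix x
    show "restrict (inv_into J (restrict (inv_into I f) J)) I x = f x"
    proof (cases "x \<in> I")
      case True
      have "bij_betw (restrict (inv_into I f) J) J I"
        using bij_betw_inv_into[OF that(2)] by simp
      moreover have "f x \<in> J" "restrict (inv_into I f) J (f x) = x"
        using True that by (auto simp: bij_betw_inv_into_left)
      ultimately show ?thesis
        using True by (auto simp: bij_betw_def intro!: inv_into_f_eq)
    qed (use that in \<open>auto simp: PiE_def extensional_def\<close>)
  qed
  have **: "restrict (inv_into I f) J \<in> {g \<in> J \<rightarrow>\<^sub>E I. bij_betw g J I}"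
    if "bij_betw f I J" for f :: "'x \<Rightarrow> 'y" and I J
    using bij_betw_inv_into[OF that] by (auto dest: bij_betwE)
  show "restrict (inv_into J (restrict (inv_into I f) J)) I = f"
    if "f \<in> {f \<in> I \<rightarrow>\<^sub>E J. bij_betw f I J}" for f
    using that * by blast
  show "restrict (inv_into I f) J \<in> {g \<in> J \<rightarrow>\<^sub>E I. bij_betw g J I}"
    if "f \<in> {f \<in> I \<rightarrow>\<^sub>E J. bij_betw f I J}" for f
    using that ** by blast
  show "restrict (inv_into I (restrict (inv_into J g) I)) J = g"
    if "g \<in> {g \<in> J \<rightarrow>\<^sub>E I. bij_betw g J I}" for g
    using that * by blast
  show "restrict (inv_into J g) I \<in> {f \<in> I \<rightarrow>\<^sub>E J. bij_betw f I J}"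
    if "g \<in> {g \<in> J \<rightarrow>\<^sub>E I. bij_betw g J I}" for g
    using that ** by blast
  show "(\<Prod>j\<in>J. z (restrict (inv_into I f) J j) j) = (\<Prod>i\<in>I. z i (f i))"
    if "f \<in> {f \<in> I \<rightarrow>\<^sub>E J. bij_betw f I J}" for f
  proof -
    have f: "bij_betw f I J" using that by blast
    show ?thesis
      by (rule prod.reindex_bij_betw[OF f, symmetric, THEN trans])
        (use f bij_betwE[OF f] in \<open>auto intro!: prod.cong simp: bij_betw_inv_into_left\<close>)
  qed
qed

text \<open>The bijections are sorted by the image \<open>j\<close> of the new row \<open>i\<close>,
  as in Laplace expansion but without signs.\<close>

lemma per_insert_row:
  assumes "finite I" "finite J" "i \<notin> I"
  shows "per z (insert i I) J = (\<Sum>j\<in>J. z i j * per z I (J - {j}))"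
proof -
  define F where "F j = {f \<in> I \<rightarrow>\<^sub>E (J - {j}). bij_betw f I (J - {j})}" for j
  have fin: "finite (F j)" for j
    unfolding F_def using assms by (intro finite_subset[OF _ finite_PiE[of I "\<lambda>_. J - {j}"]]) auto
  have "per z (insert i I) J = (\<Sum>(j, g)\<in>Sigma J F. \<Prod>l\<in>insert i I. z l ((g(i := j)) l))"
    unfolding per_def
  proof (rule sum.reindex_bij_witness
      \<comment> \<open>Resetting the value at \<open>i\<close> to \<open>undefined\<close> makes
        the remaining function extensional on \<open>I\<close>.\<close>
      [where i = "\<lambda>(j, g). g(i := j)" and j = "\<lambda>f. (f i, f(i := undefined))"])
    fix f assume f: "f \<in> {f \<in> insert i I \<rightarrow>\<^sub>E J. bij_betw f (insert i I) J}"
    then have bij: "bij_betw f (insert i I) J" and fi: "f i \<in> J" by auto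
    have "inj_on f I" "J = insert (f i) (f ` I)" "f i \<notin> f ` I"
      using bij assms(3) by (auto simp: bij_betw_def)
    moreover from this have "J - {f i} = f ` I" by blast
    ultimately have "bij_betw f I (J - {f i})" by (simp add: bij_betw_def)
    then have "bij_betw (f(i := undefined)) I (J - {f i})"
      by (rule bij_betw_cong[THEN iffD1, rotated]) (use assms(3) in auto)
    then show "(f i, f(i := undefined)) \<in> Sigma J F"
      using f fi bij assms(3) unfolding F_def
      by (auto simp: PiE_def extensional_def bij_betw_def)
  next
    fix p assume p: "p \<in> Sigma J F"
    obtain j g where jg: "p = (j, g)" by force
    have g: "g \<in> I \<rightarrow>\<^sub>E (J - {j})" "bij_betw g I (J - {j})" and j: "j \<in> J"
      using p by (auto simp: jg F_def)
    have "bij_betw (g(i := j)) I (J - {j})"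
      using g(2) by (rule bij_betw_cong[THEN iffD1, rotated]) (use assms(3) in auto)
    then have "bij_betw (g(i := j)) (insert i I) J"
      using j assms(3) by (auto simp: bij_betw_def insert_absorb)
    then show "(case p of (j, g) \<Rightarrow> g(i := j))
        \<in> {f \<in> insert i I \<rightarrow>\<^sub>E J. bij_betw f (insert i I) J}"
      using g(1) j by (auto simp: jg PiE_def extensional_def)
    show "((case p of (j, g) \<Rightarrow> g(i := j)) i, (case p of (j, g) \<Rightarrow> g(i := j))(i := undefined)) = p"
      using g(1) assms(3) by (auto simp: jg PiE_def extensional_def)
  qed (auto intro!: prod.cong)
  also have "\<dots> = (\<Sum>j\<in>J. \<Sum>g\<in>F j. \<Prod>l\<in>insert i I. z l ((g(i := j)) l))"
    using assms fin by (simp add: sum.Sigma)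
  also have "\<dots> = (\<Sum>j\<in>J. z i j * per z I (J - {j}))"
  proof (rule sum.cong[OF refl])
    fix j assume "j \<in> J"
    have "(\<Prod>l\<in>insert i I. z l ((g(i := j)) l)) = z i j * (\<Prod>l\<in>I. z l (g l))" for g
    proof -
      have "(\<Prod>l\<in>I. z l ((g(i := j)) l)) = (\<Prod>l\<in>I. z l (g l))"
        using assms(3) by (intro prod.cong) auto
      then show ?thesis
        using assms(1,3) by simp
    qed
    then show "(\<Sum>g\<in>F j. \<Prod>l\<in>insert i I. z l ((g(i := j)) l)) = z i j * per z I (J - {j})"
      by (simp add: per_def F_def sum_distrib_left)
  qed
  finally show ?thesis .
qed

lemma per_insert_col:
  assumes "finite I" "finite J" "j \<notin> J"
  shows "per z I (insert j J) = (\<Sum>i\<in>I. z i j * per z (I - {i}) J)"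
  using per_insert_row[OF assms(2,1,3), of "\<lambda>j i. z i j"]
  by (simp add: per_transpose[of z])

text \<open>Extensional bijections and permutations of \<open>S\<close> differ only off
  \<open>S\<close>, where the value is \<open>undefined\<close> or the argument itself. This form
  matches the Leibniz formula for determinants.\<close>

lemma per_permutes: "per z S S = (\<Sum>p | p permutes S. \<Prod>i\<in>S. z i (p i))"
  unfolding per_def
proof (rule sum.reindex_bij_witness
    [where i = "\<lambda>p. restrict p S" and j = "\<lambda>f x. if x \<in> S then f x else x"])
  fix f assume f: "f \<in> {f \<in> S \<rightarrow>\<^sub>E S. bij_betw f S S}"
  then show "restrict (\<lambda>x. if x \<in> S then f x else x) S = f"
    by (auto simp: PiE_def extensional_def fun_eq_iff)
  have "bij_betw (\<lambda>x. if x \<in> S then f x else x) S S"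
    using f by (auto cong: bij_betw_cong)
  then show "(\<lambda>x. if x \<in> S then f x else x) \<in> {p. p permutes S}"
    by (auto intro: bij_imp_permutes)
  show "(\<Prod>i\<in>S. z i (if i \<in> S then f i else i)) = (\<Prod>i\<in>S. z i (f i))"
    by (auto intro: prod.cong)
next
  fix p assume "p \<in> {p. p permutes S}"
  then have p: "p permutes S" by simp
  show "(\<lambda>x. if x \<in> S then restrict p S x else x) = p"
    using permutes_not_in[OF p] by (auto simp: fun_eq_iff)
  show "restrict p S \<in> {f \<in> S \<rightarrow>\<^sub>E S. bij_betw f S S}"
    using permutes_imp_bij[OF p] by (auto dest: bij_betwE)
qed

section \<open>Permanents of matrices close to the all-ones matrix\<close>

text \<open>Seen from 0, the disk of radius \<open>r\<close> about 1 has half-angle arcsin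
  \<open>r\<close>, so the sine of the argument of \<open>x\<close> is at most \<open>r\<close> in
  absolute value.\<close>

lemma Im_sq_le_near_1:
  fixes x :: complex
  assumes "cmod (x - 1) \<le> r" "r < 1"
  shows "(Im x)\<^sup>2 \<le> r\<^sup>2 * (cmod x)\<^sup>2"
proof -
  have r: "0 \<le> r" using assms(1) norm_ge_zero order_trans by blast
  have "(cmod (x - 1))\<^sup>2 \<le> r\<^sup>2"
    using assms(1) by (intro power_mono) auto
  then have 1: "(Re x - 1)\<^sup>2 + (Im x)\<^sup>2 \<le> r\<^sup>2" by (simp add: cmod_power2)
  have "r\<^sup>2 \<le> 1" using r assms(2) by (simp add: power_le_one)
  then have "(1 - r\<^sup>2) * ((Re x - 1)\<^sup>2 + (Im x)\<^sup>2) \<le> (1 - r\<^sup>2) * r\<^sup>2"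
    by (intro mult_left_mono 1) auto
  \<comment> \<open>This square is the slack in the inequality on the boundary circle; it vanishes
    where the tangents from 0 touch the circle.\<close>
  moreover have "0 \<le> (Re x - (1 - r\<^sup>2))\<^sup>2" by simp
  ultimately have "(Im x)\<^sup>2 \<le> r\<^sup>2 * ((Re x)\<^sup>2 + (Im x)\<^sup>2)"
    by (simp add: algebra_simps power2_eq_square)
  then show ?thesis
    by (simp add: cmod_power2)
qed

text \<open>Both arguments are at most arcsin \<open>r\<close> in absolute value, so the angle
  between \<open>x\<close> and \<open>y\<close> is at most twice that, and cos(2 arcsin
  \<open>r\<close>) is \<open>1 - 2 * r\<^sup>2\<close>.\<close>

lemma Re_mult_cnj_near_1:
  fixes x y :: complex
  assumes "cmod (x - 1) \<le> r" "cmod (y - 1) \<le> r" "r < 1"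
  shows "Re (x * cnj y) \<ge> (1 - 2 * r\<^sup>2) * (cmod x * cmod y)"
proof -
  have r: "0 \<le> r" using assms(1) norm_ge_zero order_trans by blast
  then have r1: "0 \<le> 1 - r\<^sup>2" using assms(3) by (simp add: power_le_one)
  \<comment> \<open>The cosine of arcsin \<open>r\<close>.\<close>
  define c where "c = sqrt (1 - r\<^sup>2)"
  have c: "0 \<le> c" "c\<^sup>2 = 1 - r\<^sup>2" using r1 by (simp_all add: c_def)
  have Re: "Re w \<ge> c * cmod w" if "cmod (w - 1) \<le> r" for w
  proof (rule power2_le_imp_le)
    have "(c * cmod w)\<^sup>2 = (1 - r\<^sup>2) * (cmod w)\<^sup>2"
      by (simp only: c(2) power_mult_distrib)
    also have "\<dots> \<le> (Re w)\<^sup>2"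
      using Im_sq_le_near_1[OF that assms(3)] by (simp add: cmod_power2 algebra_simps)
    finally show "(c * cmod w)\<^sup>2 \<le> (Re w)\<^sup>2" .
    show "0 \<le> Re w"
      using abs_Re_le_cmod[of "w - 1"] that assms(3) by simp
  qed
  have Im: "\<bar>Im w\<bar> \<le> r * cmod w" if "cmod (w - 1) \<le> r" for w
    by (rule power2_le_imp_le)
      (use Im_sq_le_near_1[OF that assms(3)] r in \<open>auto simp: power_mult_distrib\<close>)
  have nonneg: "0 \<le> c * cmod w" for w :: complex using c(1) by simp
  then have "0 \<le> Re x" using Re[OF assms(1)] by (rule order_trans)
  then have "(c * cmod x) * (c * cmod y) \<le> Re x * Re y"
    using Re[OF assms(1)] Re[OF assms(2)] nonneg by (intro mult_mono)
  moreover have "\<bar>Im x\<bar> * \<bar>Im y\<bar> \<le> (r * cmod x) * (r * cmod y)"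
    using Im[OF assms(1)] Im[OF assms(2)] r by (intro mult_mono) auto
  then have "- (Im x * Im y) \<le> (r * cmod x) * (r * cmod y)"
    using abs_ge_minus_self[of "Im x * Im y"] by (simp only: abs_mult)
  moreover have "(c * cmod x) * (c * cmod y) = (1 - r\<^sup>2) * (cmod x * cmod y)"
    unfolding c(2)[symmetric] by (simp add: power2_eq_square)
  ultimately show ?thesis
    by (simp add: algebra_simps power2_eq_square)
qed

text \<open>Project the sum onto the direction of the single vector \<open>u i\<close>: each term
  contributes at least \<open>c\<close> times its length.\<close>

lemma norm_sum_ge_of_small_angles:
  fixes u :: "'a \<Rightarrow> complex"
  assumes "finite I" "i \<in> I" "u i \<noteq> 0"
    and angle: "\<And>k. k \<in> I \<Longrightarrow> Re (u k * cnj (u i)) \<ge> c * (cmod (u k) * cmod (u i))"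
  shows "c * (\<Sum>k\<in>I. cmod (u k)) \<le> cmod (\<Sum>k\<in>I. u k)"
proof -
  have "(c * (\<Sum>k\<in>I. cmod (u k))) * cmod (u i) = (\<Sum>k\<in>I. c * (cmod (u k) * cmod (u i)))"
    by (simp add: sum_distrib_left sum_distrib_right mult_ac)
  also have "\<dots> \<le> (\<Sum>k\<in>I. Re (u k * cnj (u i)))"
    by (intro sum_mono angle)
  also have "\<dots> = Re ((\<Sum>k\<in>I. u k) * cnj (u i))"
    by (simp only: sum_distrib_right Re_sum)
  also have "\<dots> \<le> cmod ((\<Sum>k\<in>I. u k) * cnj (u i))"
    by (rule complex_Re_le_cmod)
  finally show ?thesis
    using assms(3) by (simp add: norm_mult)
qed

text \<open>Any cosine bound \<open>c\<close> with \<open>\<delta> / c \<le> r\<close> and \<open>1 - 2 r\<^sup>2 \<ge> c\<close> reproduces itself; here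
  \<open>c = 3/4\<close> and \<open>r = 0.26\<close>.\<close>

lemma weighted_sums_small_angle:
  fixes u p q :: "'a \<Rightarrow> complex"
  assumes I: "finite I" "I \<noteq> {}" and u: "\<And>i. i \<in> I \<Longrightarrow> u i \<noteq> 0"
    and angle: "\<And>i k. i \<in> I \<Longrightarrow> k \<in> I \<Longrightarrow>
      Re (u i * cnj (u k)) \<ge> 3/4 * (cmod (u i) * cmod (u k))"
    and p: "\<And>i. i \<in> I \<Longrightarrow> cmod (p i - 1) \<le> 0.195"
    and q: "\<And>i. i \<in> I \<Longrightarrow> cmod (q i - 1) \<le> 0.195"
  defines "v \<equiv> \<Sum>i\<in>I. p i * u i" and "w \<equiv> \<Sum>i\<in>I. q i * u i"
  shows "v \<noteq> 0" "Re (v * cnj w) \<ge> 3/4 * (cmod v * cmod w)"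
proof -
  \<comment> \<open>The unweighted sum is the common reference: both weighted sums are compared with
    it.\<close>
  define U where "U = (\<Sum>i\<in>I. u i)"
  obtain i where i: "i \<in> I" using I by blast
  have le: "3/4 * (\<Sum>k\<in>I. cmod (u k)) \<le> cmod U"
    unfolding U_def using I(1) i u[OF i] angle by (intro norm_sum_ge_of_small_angles) auto
  have "cmod (u i) \<le> (\<Sum>k\<in>I. cmod (u k))"
    using I i by (intro member_le_sum) auto
  moreover have "0 < cmod (u i)" using u[OF i] by simp
  ultimately have "0 < cmod U" using le by linarith
  then have U: "U \<noteq> 0" by simp
  \<comment> \<open>The bound is 0.195 / (3/4) = 0.26: the error is at most 0.195 times the total
    length, which is at most 4/3 times \<open>cmod U\<close>.\<close>
  have *: "cmod ((\<Sum>i\<in>I. s i * u i) / U - 1) \<le> 0.26"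
    if "\<And>i. i \<in> I \<Longrightarrow> cmod (s i - 1) \<le> 0.195" for s
  proof -
    have "cmod ((\<Sum>i\<in>I. s i * u i) - U) = cmod (\<Sum>i\<in>I. (s i - 1) * u i)"
      by (simp add: U_def sum_subtractf algebra_simps)
    also have "\<dots> \<le> (\<Sum>i\<in>I. 0.195 * cmod (u i))"
      using that by (intro sum_norm_le) (simp only: norm_mult, intro mult_right_mono norm_ge_zero)
    also have "\<dots> = 0.195 * (\<Sum>i\<in>I. cmod (u i))"
      by (simp add: sum_distrib_left)
    also have "\<dots> \<le> 0.26 * cmod U"
      using le by simp
    finally have "cmod ((\<Sum>i\<in>I. s i * u i) - U) / cmod U \<le> 0.26"
      using U by (simp add: divide_le_eq)
    moreover have "(\<Sum>i\<in>I. s i * u i) / U - 1 = ((\<Sum>i\<in>I. s i * u i) - U) / U"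
      using U by (simp add: diff_divide_distrib)
    ultimately show ?thesis by (simp add: norm_divide)
  qed
  have v: "cmod (v / U - 1) \<le> 0.26" and w: "cmod (w / U - 1) \<le> 0.26"
    using * p q by (auto simp: v_def w_def)
  show "v \<noteq> 0" using v by auto
  \<comment> \<open>Here 1 - 2 * 0.26^2 = 0.8648. Multiplying by \<open>(cmod U)\<^sup>2\<close>
    afterwards removes the normalisation by \<open>U\<close>.\<close>
  have "3/4 * (cmod (v / U) * cmod (w / U)) \<le> (1 - 2 * 0.26\<^sup>2) * (cmod (v / U) * cmod (w / U))"
    by (intro mult_right_mono) (auto simp: power2_eq_square)
  also have "\<dots> \<le> Re ((v / U) * cnj (w / U))"
    using v w by (intro Re_mult_cnj_near_1) auto
  finally have "3/4 * (cmod (v / U) * cmod (w / U)) * (cmod U)\<^sup>2 \<le> Re ((v / U) * cnj (w / U)) * (cmod U)\<^sup>2"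
    by (intro mult_right_mono) auto
  moreover have "Re ((v / U) * cnj (w / U)) * (cmod U)\<^sup>2 = Re (v * cnj w)"
  proof -
    have "v * cnj w = (v / U) * cnj (w / U) * of_real ((cmod U)\<^sup>2)"
      using U by (simp add: complex_norm_square del: of_real_power)
    then show ?thesis by (simp only: times_complex.sel Re_complex_of_real Im_complex_of_real mult_zero_right diff_zero)
  qed
  moreover have "3/4 * (cmod (v / U) * cmod (w / U)) * (cmod U)\<^sup>2 = 3/4 * (cmod v * cmod w)"
    using U by (simp add: norm_divide power2_eq_square)
  ultimately show "Re (v * cnj w) \<ge> 3/4 * (cmod v * cmod w)"
    by simp
qed

text \<open>Expanded along the column \<open>j\<close> or \<open>k\<close>, both permanents are
  weighted sums of the same minors, with weights near 1. By induction the minors are nonzero with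
  small mutual angles, so the previous lemma applies. The case \<open>j = k\<close> is allowed and
  supplies the nonvanishing.\<close>

lemma per_near_1_small_angle:
  fixes z :: "'a \<Rightarrow> 'a \<Rightarrow> complex"
  assumes "finite I" "finite J" "card I = Suc (card J)" "j \<notin> J" "k \<notin> J"
    and "\<And>i l. i \<in> I \<Longrightarrow> l \<in> insert j (insert k J) \<Longrightarrow> cmod (z i l - 1) \<le> 0.195"
  shows "per z I (insert j J) \<noteq> 0 \<and>
    Re (per z I (insert j J) * cnj (per z I (insert k J)))
      \<ge> 3/4 * (cmod (per z I (insert j J)) * cmod (per z I (insert k J)))"
  using assms
proof (induction "card J" arbitrary: z I J j k rule: less_induct)
  case less
  have card_del: "card (I - {i}) = card J" if "i \<in> I" for i
    using that less.prems by simp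
  have nz: "per z (I - {i}) J \<noteq> 0" if i: "i \<in> I" for i
  proof (cases "J = {}")
    case True
    then have "I - {i} = {}" using card_del[OF i] less.prems(1) by simp
    then show ?thesis using True by (simp only: per_empty) simp
  next
    case False
    then obtain l J' where J: "J = insert l J'" "l \<notin> J'"
      by (meson Set.set_insert ex_in_conv)
    then have card_J: "card J = Suc (card J')"
      using less.prems(2) by simp
    show ?thesis
      unfolding J(1)
      \<comment> \<open>The minor is a single permanent, so the same column \<open>l\<close> is
        taken in both roles.\<close>
      by (rule less.hyps[of J' "I - {i}" l l, THEN conjunct1])
        (use less.prems J card_J card_del[OF i] in auto)
  qed
  have angle: "Re (per z (I - {i}) J * cnj (per z (I - {i'}) J))
      \<ge> 3/4 * (cmod (per z (I - {i}) J) * cmod (per z (I - {i'}) J))"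
    if i: "i \<in> I" "i' \<in> I" for i i'
  proof (cases "i = i'")
    case True
    have "3/4 * (cmod w * cmod w) \<le> Re (w * cnj w)" for w
      using zero_le_power2[of "cmod w"]
      by (simp only: complex_norm_square[symmetric] Re_complex_of_real) (simp add: power2_eq_square)
    then show ?thesis using True by simp
  next
    case False
    \<comment> \<open>The two minors share the rows \<open>K\<close> and differ in one row. After
      transposition they differ in one column, with \<open>K\<close> in the role of \<open>J\<close>
      and \<open>J\<close> in that of \<open>I\<close>.\<close>
    define K where "K = I - {i, i'}"
    have K: "I - {i} = insert i' K" "I - {i'} = insert i K" "i \<notin> K" "i' \<notin> K" "finite K"
      using False i less.prems(1) by (auto simp: K_def)
    then have card_J: "card J = Suc (card K)"
      using card_del[OF i(1)] by simp
    show ?thesis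
      unfolding K(1,2) per_transpose[of z]
      by (rule less.hyps[of K J i' i "\<lambda>j i. z i j", THEN conjunct2])
        (use less.prems card_J i K(3-5) in \<open>auto simp: K_def\<close>)
  qed
  have "I \<noteq> {}" using less.prems by auto
  then show ?case
    unfolding per_insert_col[OF less.prems(1,2,4)] per_insert_col[OF less.prems(1,2,5)]
    using weighted_sums_small_angle[of I "\<lambda>i. per z (I - {i}) J" "\<lambda>i. z i j" "\<lambda>i. z i k",
        OF less.prems(1) _ nz angle less.prems(6) less.prems(6)]
    by blast
qed

theorem per_near_1_nonzero:
  fixes z :: "'a \<Rightarrow> 'a \<Rightarrow> complex"
  assumes "finite I" "finite J" "card I = card J"
    and "\<And>i j. i \<in> I \<Longrightarrow> j \<in> J \<Longrightarrow> cmod (z i j - 1) \<le> 0.195"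
  shows "per z I J \<noteq> 0"
proof (cases "J = {}")
  case True
  then show ?thesis using assms by simp
next
  case False
  then obtain j J' where J: "J = insert j J'" "j \<notin> J'"
    by (meson Set.set_insert ex_in_conv)
  show ?thesis
    unfolding J(1) by (rule per_near_1_small_angle[of _ _ j j, THEN conjunct1]) (use assms J in auto)
qed

section \<open>Borchardt's identity and the Cauchy determinant\<close>

text \<open>Expand each determinant on the right over permutations \<open>p\<close>. For fixed
  \<open>p\<close>, the composite \<open>\<tau> \<circ> p\<close> runs through all permutations, so
  the inner sum over \<open>\<tau>\<close> is the permanent.\<close>

lemma det_mult_per:
  fixes m :: "nat \<Rightarrow> nat \<Rightarrow> 'a::comm_ring_1"
  shows "Determinant.det (Matrix.mat n n (\<lambda>(i, j). m i j)) * per m {..<n} {..<n}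
    = (\<Sum>\<tau> | \<tau> permutes {..<n}. Determinant.det (Matrix.mat n n (\<lambda>(i, j). m i j * m i (\<tau> j))))"
proof -
  have det: "Determinant.det (Matrix.mat n n (\<lambda>(i, j). g i j))
      = (\<Sum>p | p permutes {..<n}. signof p * (\<Prod>i<n. g i (p i)))" for g :: "nat \<Rightarrow> nat \<Rightarrow> 'a"
  proof -
    have "Determinant.det (Matrix.mat n n (\<lambda>(i, j). g i j)) = (\<Sum>p | p permutes {..<n}.
        signof p * (\<Prod>i<n. Matrix.mat n n (\<lambda>(i, j). g i j) $$ (i, p i)))"
      by (simp add: Determinant.det_def lessThan_atLeast0)
    also have "\<dots> = (\<Sum>p | p permutes {..<n}. signof p * (\<Prod>i<n. g i (p i)))"
      using permutes_in_image[of _ "{..<n}"]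
      by (intro sum.cong refl arg_cong2[where f = "(*)"] prod.cong) auto
    finally show ?thesis .
  qed
  have "(\<Sum>\<tau> | \<tau> permutes {..<n}. Determinant.det (Matrix.mat n n (\<lambda>(i, j). m i j * m i (\<tau> j))))
      = (\<Sum>p | p permutes {..<n}. \<Sum>\<tau> | \<tau> permutes {..<n}.
          signof p * (\<Prod>i<n. m i (p i)) * (\<Prod>i<n. m i ((\<tau> \<circ> p) i)))"
    unfolding det by (subst sum.swap) (simp add: prod.distrib mult_ac)
  also have "\<dots> = (\<Sum>p | p permutes {..<n}. signof p * (\<Prod>i<n. m i (p i)) * per m {..<n} {..<n})"
  proof (rule sum.cong[OF refl])
    fix p assume "p \<in> {p. p permutes {..<n}}"
    then have "(\<Sum>\<tau> | \<tau> permutes {..<n}. \<Prod>i<n. m i ((\<tau> \<circ> p) i)) = per m {..<n} {..<n}"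
      unfolding per_permutes
      by (intro sum_permutations_compose_right[symmetric]) simp
    then show "(\<Sum>\<tau> | \<tau> permutes {..<n}.
          signof p * (\<Prod>i<n. m i (p i)) * (\<Prod>i<n. m i ((\<tau> \<circ> p) i)))
        = signof p * (\<Prod>i<n. m i (p i)) * per m {..<n} {..<n}"
      by (simp flip: sum_distrib_left)
  qed
  finally show ?thesis
    by (simp add: det sum_distrib_right)
qed

theorem borchardt:
  fixes x y :: "nat \<Rightarrow> 'a::field"
  assumes inj: "inj_on y {..<n}" and nz: "\<And>i j. i < n \<Longrightarrow> j < n \<Longrightarrow> x i * y j \<noteq> 1"
  shows "Determinant.det (Matrix.mat n n (\<lambda>(i, j). 1 / (1 - x i * y j)\<^sup>2))
    = Determinant.det (Matrix.mat n n (\<lambda>(i, j). 1 / (1 - x i * y j)))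
      * per (\<lambda>i j. 1 / (1 - x i * y j)) {..<n} {..<n}"
proof -
  define m where "m i j = 1 / (1 - x i * y j)" for i j
  have zero: "Determinant.det (Matrix.mat n n (\<lambda>(i, j). m i j * m i (\<tau> j))) = 0"
    if \<tau>: "\<tau> permutes {..<n}" and "\<tau> \<noteq> id" for \<tau>
  proof -
    let ?M = "Matrix.mat n n (\<lambda>(i, j). m i j * m i (\<tau> j))"
    \<comment> \<open>Distinctness of the \<open>y j\<close> makes this vector nonzero. By partial
      fractions each product becomes a difference of a term at \<open>j\<close> and the same term at
      \<open>\<tau> j\<close>, and these cancel in the sum.\<close>
    define v where "v = Matrix.vec n (\<lambda>j. y j - y (\<tau> j))"
    have \<tau>_less: "\<tau> j < n" if "j < n" for j
      using permutes_in_image[OF \<tau>, of j] that by simp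
    obtain j where "\<tau> j \<noteq> j" using \<open>\<tau> \<noteq> id\<close> by (auto simp: fun_eq_iff)
    then have j: "j < n" using permutes_not_in[OF \<tau>, of j] by auto
    then have "y j \<noteq> y (\<tau> j)"
      using inj \<tau>_less \<open>\<tau> j \<noteq> j\<close> by (auto simp: inj_on_def)
    then have "v \<noteq> 0\<^sub>v n"
      using j by (metis eq_iff_diff_eq_0 index_vec index_zero_vec(1) v_def)
    moreover have "?M *\<^sub>v v = 0\<^sub>v n"
    proof (rule eq_vecI)
      fix i assume "i < dim_vec (0\<^sub>v n)"
      then have i: "i < n" by simp
      have "(?M *\<^sub>v v) $ i = (\<Sum>j<n. m i j * m i (\<tau> j) * (y j - y (\<tau> j)))"
        using i by (simp add: scalar_prod_def v_def lessThan_atLeast0)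
      also have "\<dots> = (\<Sum>j<n. y j * m i j - y (\<tau> j) * m i (\<tau> j))"
      proof (rule sum.cong[OF refl])
        fix j assume "j \<in> {..<n}"
        then have "1 - x i * y j \<noteq> 0" "1 - x i * y (\<tau> j) \<noteq> 0"
          using nz[OF i] \<tau>_less by force+
        then show "m i j * m i (\<tau> j) * (y j - y (\<tau> j)) = y j * m i j - y (\<tau> j) * m i (\<tau> j)"
          by (simp add: m_def divide_simps) (simp add: algebra_simps)
      qed
      also have "\<dots> = 0"
        using sum.permute[OF \<tau>, of "\<lambda>j. y j * m i j"] by (simp add: sum_subtractf o_def)
      finally show "(?M *\<^sub>v v) $ i = 0\<^sub>v n $ i" using i by simp
    qed auto
    ultimately show ?thesis
      by (subst det_0_iff_vec_prod_zero[of _ n]) (auto simp: v_def intro!: exI[of _ v])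
  qed
  have "(\<Sum>\<tau> | \<tau> permutes {..<n}. Determinant.det (Matrix.mat n n (\<lambda>(i, j). m i j * m i (\<tau> j))))
      = (\<Sum>\<tau> \<in> {id}. Determinant.det (Matrix.mat n n (\<lambda>(i, j). m i j * m i (\<tau> j))))"
    using zero by (intro sum.mono_neutral_right) (auto simp: finite_permutations permutes_id)
  then show ?thesis
    using det_mult_per[of n m]
    by (simp add: m_def[abs_def] power2_eq_square)
qed

text \<open>A kernel vector \<open>v\<close> gives a rational function, the sum of
  \<open>v $ j / (1 - y j * t)\<close>, vanishing at all \<open>x i\<close>. Its numerator
  \<open>P\<close> has too many roots, hence is zero, and the poles then recover each
  \<open>v $ j\<close>.\<close>

lemma cauchy_det_nonzero:
  fixes x y :: "nat \<Rightarrow> 'a::field"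
  assumes x: "inj_on x {..<n}" and y: "inj_on y {..<n}"
    and nz: "\<And>i j. i < n \<Longrightarrow> j < n \<Longrightarrow> x i * y j \<noteq> 1"
  shows "Determinant.det (Matrix.mat n n (\<lambda>(i, j). 1 / (1 - x i * y j))) \<noteq> 0"
proof
  let ?M = "Matrix.mat n n (\<lambda>(i, j). 1 / (1 - x i * y j))"
  assume "Determinant.det ?M = 0"
  then obtain v where v: "v \<in> carrier_vec n" "v \<noteq> 0\<^sub>v n" "?M *\<^sub>v v = 0\<^sub>v n"
    using det_0_iff_vec_prod_zero[of ?M n] by auto
  define L where "L j = [:1, - y j:]" for j
  define P where "P = (\<Sum>j<n. smult (v $ j) (\<Prod>k\<in>{..<n} - {j}. L k))"
  have root: "poly P (x i) = 0" if i: "i < n" for i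
  proof -
    have L: "poly (L j) (x i) \<noteq> 0" if "j < n" for j
      using nz[OF i that] by (simp add: L_def)
    have "poly P (x i) = (\<Sum>j<n. v $ j * (\<Prod>k\<in>{..<n} - {j}. poly (L k) (x i)))"
      by (simp add: P_def poly_sum poly_prod)
    also have "\<dots> = (\<Sum>j<n. (\<Prod>k<n. poly (L k) (x i)) * (1 / (1 - x i * y j) * v $ j))"
    proof (rule sum.cong[OF refl])
      fix j assume j: "j \<in> {..<n}"
      then have "(\<Prod>k<n. poly (L k) (x i)) = (1 - x i * y j) * (\<Prod>k\<in>{..<n} - {j}. poly (L k) (x i))"
        by (subst prod.remove[of _ j]) (auto simp: L_def)
      then show "v $ j * (\<Prod>k\<in>{..<n} - {j}. poly (L k) (x i))
          = (\<Prod>k<n. poly (L k) (x i)) * (1 / (1 - x i * y j) * v $ j)"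
        using nz[OF i, of j] j by simp
    qed
    also have "\<dots> = (\<Prod>k<n. poly (L k) (x i)) * (?M *\<^sub>v v) $ i"
      using i v(1) by (simp add: scalar_prod_def lessThan_atLeast0 sum_distrib_left)
    finally show ?thesis using i v(3) by simp
  qed
  have deg: "degree (\<Prod>k\<in>{..<n} - {j}. L k) \<le> n - 1" if "j < n" for j
  proof -
    have "degree (\<Prod>k\<in>{..<n} - {j}. L k) \<le> (\<Sum>k\<in>{..<n} - {j}. degree (L k))"
      using degree_prod_sum_le[of "{..<n} - {j}" L] by (simp add: o_def)
    also have "\<dots> \<le> (\<Sum>k\<in>{..<n} - {j}. 1)"
      by (intro sum_mono) (simp add: L_def)
    finally show ?thesis using that by simp
  qed
  have "P = 0"
  proof (rule ccontr)
    assume "P \<noteq> 0"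
    \<comment> \<open>For \<open>n = 0\<close> the truncated bound \<open>n - 1\<close> would not
      lie below \<open>n\<close>, the number of roots.\<close>
    then have "n > 0" by (auto simp: P_def intro: Nat.gr0I)
    have "degree P \<le> n - 1"
      unfolding P_def using deg by (intro degree_sum_le) (auto intro: order_trans[OF degree_smult_le])
    moreover have "card (x ` {..<n}) \<le> card {t. poly P t = 0}"
      using root \<open>P \<noteq> 0\<close> by (intro card_mono) (auto simp: poly_roots_finite)
    ultimately show False
      using card_poly_roots_bound[OF \<open>P \<noteq> 0\<close>] x \<open>n > 0\<close> by (simp add: card_image)
  qed
  \<comment> \<open>At the pole \<open>1 / y j\<close> every summand of \<open>P\<close> except the
    one for \<open>j\<close> contains the factor \<open>L j\<close> and vanishes.\<close>
  have nonzero: "v $ j = 0" if j: "j < n" and "y j \<noteq> 0" for j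
  proof -
    define R where "R = (\<Sum>l\<in>{..<n} - {j}. smult (v $ l) (\<Prod>k\<in>{..<n} - {l}. L k))"
    have "smult (v $ j) (\<Prod>k\<in>{..<n} - {j}. L k) + R = P"
      unfolding P_def R_def using j by (subst (2) sum.remove[of _ j]) auto
    then have "L j dvd smult (v $ j) (\<Prod>k\<in>{..<n} - {j}. L k) + R"
      using \<open>P = 0\<close> by simp
    moreover have "L j dvd R"
      unfolding R_def using j by (intro dvd_sum dvd_smult dvd_prodI) auto
    ultimately have "L j dvd smult (v $ j) (\<Prod>k\<in>{..<n} - {j}. L k)"
      by (simp only: dvd_add_left_iff)
    moreover have "poly (L j) (1 / y j) = 0"
      using \<open>y j \<noteq> 0\<close> by (simp add: L_def)
    ultimately have "poly (smult (v $ j) (\<Prod>k\<in>{..<n} - {j}. L k)) (1 / y j) = 0"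
      by (elim dvdE) (simp only: poly_mult mult_zero_left)
    moreover have "poly (L k) (1 / y j) \<noteq> 0" if "k \<in> {..<n} - {j}" for k
      using that y j \<open>y j \<noteq> 0\<close> by (auto simp: L_def inj_on_def)
    ultimately show ?thesis by (auto simp: poly_prod)
  qed
  have "v $ j = 0" if j: "j < n" for j
  proof (cases "y j = 0")
    \<comment> \<open>Here \<open>L j\<close> is constant and has no root. Since the
      \<open>y\<close> are distinct, all other coefficients are already known to vanish, which
      leaves one summand of \<open>P\<close>.\<close>
    case True
    then have "v $ l = 0" if "l \<in> {..<n} - {j}" for l
      using that j y by (intro nonzero) (auto simp: inj_on_def)
    then have "P = smult (v $ j) (\<Prod>k\<in>{..<n} - {j}. L k)"
      unfolding P_def using j by (subst sum.remove[of _ j]) auto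
    then show ?thesis using \<open>P = 0\<close> by (auto simp: L_def)
  qed (use nonzero j in simp)
  then have "v = 0\<^sub>v n" using v(1) by auto
  with v(2) show False by contradiction
qed

section \<open>The determinant for points in the disk\<close>

theorem theorem2p6:
  fixes \<delta> :: real and n :: nat
    and A B :: "complex set" and a b :: "nat \<Rightarrow> complex"
  assumes "\<delta> = 0.195"
    and "bij_betw a {..<n} A"
    and "bij_betw b {..<n} B"
    and "A \<subseteq> ball 0 (sqrt (\<delta> / (1 + \<delta>)))"
    and "B \<subseteq> ball 0 (sqrt (\<delta> / (1 + \<delta>)))"
    and "A \<inter> B = {}"
  shows "Determinant.det (Matrix.mat n n (\<lambda>(i, j). 1 / (1 - a i * cnj (b j))\<^sup>2)) \<noteq> 0"
proof -
  \<comment> \<open>Absorbing the conjugation gives the entries the form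
    \<open>1 / (1 - x i * y j)\<close>.\<close>
  define y where "y j = cnj (b j)" for j
  have inj: "inj_on a {..<n}" "inj_on y {..<n}"
    using assms(2,3) by (auto simp: bij_betw_def inj_on_def y_def)
  have small: "cmod (a i * y j) < \<delta> / (1 + \<delta>)" if "i < n" "j < n" for i j
  proof -
    have "a i \<in> A" "b j \<in> B" using assms(2,3) that by (auto dest: bij_betwE)
    then have "cmod (a i) < sqrt (\<delta> / (1 + \<delta>))" "cmod (y j) < sqrt (\<delta> / (1 + \<delta>))"
      using assms(4,5) by (auto simp: y_def)
    then have "cmod (a i) * cmod (y j) < sqrt (\<delta> / (1 + \<delta>)) * sqrt (\<delta> / (1 + \<delta>))"
      by (intro mult_strict_mono') auto
    then show ?thesis by (simp add: norm_mult assms(1))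
  qed
  have nz: "a i * y j \<noteq> 1" if "i < n" "j < n" for i j
    using small[OF that] by (auto simp: assms(1))
  have "cmod (1 / (1 - a i * y j) - 1) \<le> 0.195" if "i < n" "j < n" for i j
  proof -
    let ?w = "a i * y j"
    have w: "cmod ?w < \<delta> / (1 + \<delta>)" using small[OF that] .
    have "1 / (1 - ?w) - 1 = ?w / (1 - ?w)"
      using nz[OF that] by (simp add: divide_simps)
    moreover have "1 - cmod ?w \<le> cmod (1 - ?w)"
      using norm_triangle_ineq2[of 1 ?w] by simp
    \<comment> \<open>The radius is chosen for this: t / (1 - t) equals \<open>\<delta>\<close> at t
      = \<open>\<delta> / (1 + \<delta>)\<close>, so \<open>cmod ?w\<close> is at most 0.195 times
      \<open>1 - cmod ?w\<close>.\<close>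
    then have "cmod ?w \<le> 0.195 * cmod (1 - ?w)"
      using w by (simp add: assms(1))
    ultimately show ?thesis
      using nz[OF that] by (simp add: norm_divide divide_le_eq)
  qed
  then have "per (\<lambda>i j. 1 / (1 - a i * y j)) {..<n} {..<n} \<noteq> 0"
    by (intro per_near_1_nonzero) auto
  with borchardt[OF inj(2) nz] cauchy_det_nonzero[OF inj nz] show ?thesis
    by (simp add: y_def)
qed

end
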